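(* Let $s$ be a natural number that is not a perfect square and let $i\in\{1,2\}$. Let $C_1,C_2:\mathbb{N}^2\to\mathbb{N}$ be the Cantor polynomials $C_1(x,y)=C_2(y,x)=\frac12(x+y)^2+\frac12(x+3y)$, which are bijections. Define $f:\mathbb{N}^2\to\mathbb{N}^2$ by $f(\bar a)=C_i^{-1}(s\cdot C_i(\bar a))$. Then $f$ is not definable in $(\mathbb{N},+)$.
   Context: Definable means that the graph $\{(a_1,a_2,b_1,b_2)\mid f(a_1,a_2)=(b_1,b_2)\}$ is first-order definable without parameters in $(\mathbb{N},+)$. *)

theory Defs
  imports "HOL-Library.Nat_Bijection" "HOL-Computational_Algebra.Nth_Powers"
begin

section \<open>First-order definability in the structure of the natural numbers with addition\<close>

text \<open>
  First-order formulas with equality over the signature whose only symbol is a binary function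
  symbol for addition. Variables are named by natural numbers. Negation, conjunction and
  existential quantification are primitive; the other connectives are classically expressible.
\<close>

datatype add_term = Var nat | Add add_term add_term

datatype add_form =
    Eq add_term add_term
  | Neg add_form
  | Conj add_form add_form
  | Exists nat add_form

primrec term_val :: "(nat \<Rightarrow> nat) \<Rightarrow> add_term \<Rightarrow> nat" where
  "term_val e (Var x) = e x"
| "term_val e (Add t u) = term_val e t + term_val e u"

primrec sat :: "(nat \<Rightarrow> nat) \<Rightarrow> add_form \<Rightarrow> bool" where
  "sat e (Eq t u) \<longleftrightarrow> term_val e t = term_val e u"
| "sat e (Neg p) \<longleftrightarrow> \<not> sat e p"
| "sat e (Conj p q) \<longleftrightarrow> sat e p \<and> sat e q"
| "sat e (Exists x p) \<longleftrightarrow> (\<exists>n. sat (e(x := n)) p)"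

primrec term_vars :: "add_term \<Rightarrow> nat set" where
  "term_vars (Var x) = {x}"
| "term_vars (Add t u) = term_vars t \<union> term_vars u"

primrec free_vars :: "add_form \<Rightarrow> nat set" where
  "free_vars (Eq t u) = term_vars t \<union> term_vars u"
| "free_vars (Neg p) = free_vars p"
| "free_vars (Conj p q) = free_vars p \<union> free_vars q"
| "free_vars (Exists x p) = free_vars p - {x}"

text \<open>
  A \<open>k\<close>-ary relation is given by a set of lists of length \<open>k\<close>. It is definable without parameters
  if it is the set of tuples satisfying some formula all of whose free variables are among the
  first \<open>k\<close> ones, the variable \<open>j\<close> standing for the \<open>j\<close>-th component (counted from 0).
\<close>

definition definable_rel :: "nat \<Rightarrow> nat list set \<Rightarrow> bool" where
  "definable_rel k R \<longleftrightarrow>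
     (\<exists>p. free_vars p \<subseteq> {..<k} \<and> R = {map e [0..<k] |e. sat e p})"

definition definable_fun :: "(nat \<times> nat \<Rightarrow> nat \<times> nat) \<Rightarrow> bool" where
  "definable_fun f \<longleftrightarrow>
     definable_rel 4 {[a1, a2, b1, b2] |a1 a2 b1 b2. f (a1, a2) = (b1, b2)}"


section \<open>The Cantor polynomials\<close>

text \<open>The division by 2 is exact; see \<open>two_cantor1\<close> and \<open>two_cantor2\<close>.\<close>

definition cantor1 :: "nat \<times> nat \<Rightarrow> nat" where
  "cantor1 = (\<lambda>(x, y). ((x + y)\<^sup>2 + (x + 3 * y)) div 2)"

definition cantor2 :: "nat \<times> nat \<Rightarrow> nat" where
  "cantor2 = (\<lambda>(x, y). cantor1 (y, x))"

text \<open>Only the indices 1 and 2 are meaningful.\<close>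

definition cantor :: "nat \<Rightarrow> nat \<times> nat \<Rightarrow> nat" where
  "cantor i = (if i = 1 then cantor1 else cantor2)"

lemma two_cantor1: "2 * cantor1 (x, y) = (x + y)\<^sup>2 + (x + 3 * y)"
proof -
  have "even ((x + y)\<^sup>2 + (x + 3 * y))"
    by simp
  then show ?thesis
    by (simp add: cantor1_def)
qed

lemma two_cantor2: "2 * cantor2 (x, y) = (x + y)\<^sup>2 + (y + 3 * x)"
  using two_cantor1 [of y x] by (simp add: cantor2_def add.commute)

lemma cantor2_eq_prod_encode: "cantor2 = prod_encode"
proof
  fix a :: "nat \<times> nat"
  obtain x y where a: "a = (x, y)"
    by (cases a)
  have "even ((x + y) * Suc (x + y))"
    by simp
  then have "2 * prod_encode (x, y) = (x + y) * Suc (x + y) + 2 * x"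
    by (simp add: prod_encode_def triangle_def)
  also have "\<dots> = 2 * cantor2 (x, y)"
    unfolding two_cantor2 by (simp add: power2_eq_square algebra_simps)
  finally show "cantor2 a = prod_encode a"
    by (simp add: a)
qed

lemma bij_cantor2: "bij cantor2"
  by (simp add: cantor2_eq_prod_encode bij_prod_encode)

lemma bij_cantor1: "bij cantor1"
proof -
  have "cantor1 = cantor2 \<circ> prod.swap"
    by (auto simp: cantor2_def fun_eq_iff)
  then show ?thesis
    using bij_comp [OF bij_swap bij_cantor2] by simp
qed

lemma bij_cantor: "bij (cantor i)"
  by (simp add: cantor_def bij_cantor1 bij_cantor2)

end

(*
  On the edge of the quadrant where C_i takes the triangular values n(n+1)/2, the sum of the two
  components of f is the number g n with g n (g n + 1) <= s n (n + 1) < (g n + 1) (g n + 2), so g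
  grows like sqrt s * n. If f were definable, the range of g would be definable in Presburger
  arithmetic, hence eventually periodic by quantifier elimination. As g is strictly increasing,
  an eventual period p of its range yields some c > 0 with g (n + k c) = g n + k p for all k.
  Comparing the coefficients of k^2 gives p^2 = s c^2, and s is a square.
*)

theory Submission
  imports "HOL-Decision_Procs.Cooper" "HOL-Real_Asymp.Real_Asymp" Defs
begin

section \<open>Presburger-definable sets are eventually periodic\<close>

text \<open>Only behaviour towards plus infinity matters. Allowing all multiples of \<open>d\<close>
  at once makes the passage to a common period immediate.\<close>

definition eventually_periodic :: "(int \<Rightarrow> bool) \<Rightarrow> bool" where
  "eventually_periodic P \<longleftrightarrow> (\<exists>d>0. \<exists>m. \<forall>x\<ge>m. \<forall>k::nat. P (x + int k * d) = P x)"

lemma eventually_periodicI: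
  assumes "d > 0" "\<And>x k::nat. x \<ge> m \<Longrightarrow> P (x + int k * d) = P x"
  shows "eventually_periodic P"
  using assms unfolding eventually_periodic_def by blast

lemma eventually_periodic_const: "eventually_periodic (\<lambda>x. c)"
  by (rule eventually_periodicI [of 1]) simp_all

text \<open>The product of the two periods is a common period beyond both thresholds. This handles
  every propositional connective, through the choice of \<open>h\<close>.\<close>

lemma eventually_periodic_comp2:
  assumes "eventually_periodic P" "eventually_periodic Q"
  shows "eventually_periodic (\<lambda>x. h (P x) (Q x))"
proof -
  obtain d m where d: "d > 0" and P: "\<And>x k::nat. x \<ge> m \<Longrightarrow> P (x + int k * d) = P x"
    using assms(1) unfolding eventually_periodic_def by blast
  obtain d' m' where d': "d' > 0" and Q: "\<And>x k::nat. x \<ge> m' \<Longrightarrow> Q (x + int k * d') = Q x"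
    using assms(2) unfolding eventually_periodic_def by blast
  have "P (x + int k * (d * d')) = P x" if "x \<ge> max m m'" for x k
    using P [of x "k * nat d'"] that d' by (simp add: mult_ac)
  moreover have "Q (x + int k * (d * d')) = Q x" if "x \<ge> max m m'" for x k
    using Q [of x "k * nat d"] that d by (simp add: mult_ac)
  moreover have "d * d' > 0"
    using d d' by simp
  ultimately show ?thesis
    by (intro eventually_periodicI [of "d * d'" "max m m'"]) simp_all
qed

text \<open>An affine function has constant sign once \<open>x\<close> exceeds the absolute value of
  \<open>b\<close>. Every atom comparing with 0 depends on the sign alone, so the parameter
  \<open>h\<close> covers all of them.\<close>

lemma eventually_periodic_sgn_affine:
  fixes a b :: int
  shows "eventually_periodic (\<lambda>x. h (sgn (a * x + b)))"
proof -
  have "sgn (a * x + b) = (if a = 0 then sgn b else sgn a)" if "x \<ge> \<bar>b\<bar> + 1" for x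
  proof -
    consider "a = 0" | "a \<ge> 1" | "a \<le> -1"
      by linarith
    then show ?thesis
    proof cases
      case 2
      then have "1 * x \<le> a * x"
        using that by (intro mult_right_mono) auto
      then show ?thesis
        using 2 that by auto
    next
      case 3
      then have "a * x \<le> -1 * x"
        using that by (intro mult_right_mono) auto
      then show ?thesis
        using 3 that by (auto simp: sgn_if)
    qed simp
  qed
  then show ?thesis
    by (intro eventually_periodicI [of 1 "\<bar>b\<bar> + 1"]) simp_all
qed

lemma eventually_periodic_dvd_affine:
  fixes a b d :: int
  shows "eventually_periodic (\<lambda>x. d dvd a * x + b)"
proof (cases "d = 0")
  case True
  \<comment> \<open>Divisibility by 0 means being 0, a condition on the sign.\<close>
  then show ?thesis
    using eventually_periodic_sgn_affine [of "\<lambda>z. z = 0" a b] by (simp add: sgn_0_0)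
next
  case False
  have "d dvd a * (x + int k * \<bar>d\<bar>) + b \<longleftrightarrow> d dvd a * x + b" for x k
  proof -
    have "a * (x + int k * \<bar>d\<bar>) + b = (a * x + b) + (a * int k * sgn d) * d"
      by (simp add: algebra_simps abs_sgn)
    then show ?thesis
      by (metis dvd_add_times_triv_right_iff)
  qed
  then show ?thesis
    using False by (intro eventually_periodicI [of "\<bar>d\<bar>"]) simp_all
qed

text \<open>With the other variables fixed at \<open>bs\<close>, their contribution goes into the
  constant \<open>b\<close>.\<close>

lemma Inum_affine: "\<exists>a b. \<forall>x. Inum (x # bs) t = a * x + b"
proof (induction t)
  case (C c)
  show ?case
    by (intro exI [of _ 0] exI [of _ c]) simp
next
  case (Bound n)
  show ?case
  proof (cases n)
    case 0
    then show ?thesis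
      by (intro exI [of _ 1] exI [of _ 0]) simp
  next
    case (Suc m)
    then show ?thesis
      by (intro exI [of _ 0] exI [of _ "bs ! m"]) simp
  qed
next
  case (CN n c t)
  then obtain a b where ab: "\<forall>x. Inum (x # bs) t = a * x + b"
    by blast
  show ?case
  proof (cases n)
    case 0
    with ab show ?thesis
      by (intro exI [of _ "c + a"] exI [of _ b]) (simp add: algebra_simps)
  next
    case (Suc m)
    with ab show ?thesis
      by (intro exI [of _ a] exI [of _ "c * bs ! m + b"]) (simp add: algebra_simps)
  qed
next
  case (Neg t)
  then obtain a b where "\<forall>x. Inum (x # bs) t = a * x + b"
    by blast
  then show ?case
    by (intro exI [of _ "- a"] exI [of _ "- b"]) (simp add: algebra_simps)
next
  case (Add t u)
  then obtain a b a' b' where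
    "\<forall>x. Inum (x # bs) t = a * x + b" "\<forall>x. Inum (x # bs) u = a' * x + b'"
    by blast
  then show ?case
    by (intro exI [of _ "a + a'"] exI [of _ "b + b'"]) (simp add: algebra_simps)
next
  case (Sub t u)
  then obtain a b a' b' where
    "\<forall>x. Inum (x # bs) t = a * x + b" "\<forall>x. Inum (x # bs) u = a' * x + b'"
    by blast
  then show ?case
    by (intro exI [of _ "a - a'"] exI [of _ "b - b'"]) (simp add: algebra_simps)
next
  case (Mul c t)
  then obtain a b where "\<forall>x. Inum (x # bs) t = a * x + b"
    by blast
  then show ?case
    by (intro exI [of _ "c * a"] exI [of _ "c * b"]) (simp add: algebra_simps)
qed

lemma eventually_periodic_sgn_Inum: "eventually_periodic (\<lambda>x. h (sgn (Inum (x # bs) t)))"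
  using Inum_affine [of bs t] eventually_periodic_sgn_affine [of h] by auto

lemma eventually_periodic_dvd_Inum: "eventually_periodic (\<lambda>x. d dvd Inum (x # bs) t)"
  using Inum_affine [of bs t] eventually_periodic_dvd_affine [of d] by auto

lemma eventually_periodic_qfree:
  "qfree p \<Longrightarrow> eventually_periodic (\<lambda>x. Ifm bbs (x # bs) p)"
proof (induction p)
  case (Lt t)
  show ?case
    using eventually_periodic_sgn_Inum [of "\<lambda>z. z < 0" bs t] by simp
next
  case (Le t)
  show ?case
    using eventually_periodic_sgn_Inum [of "\<lambda>z. z \<noteq> 1" bs t] by (simp add: sgn_1_pos not_less)
next
  case (Gt t)
  show ?case
    using eventually_periodic_sgn_Inum [of "\<lambda>z. z > 0" bs t] by simp
next
  case (Ge t)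
  show ?case
    using eventually_periodic_sgn_Inum [of "\<lambda>z. z \<noteq> -1" bs t] by (simp add: sgn_1_neg not_less)
next
  case (Eq t)
  show ?case
    using eventually_periodic_sgn_Inum [of "\<lambda>z. z = 0" bs t] by (simp add: sgn_0_0)
next
  case (NEq t)
  show ?case
    using eventually_periodic_sgn_Inum [of "\<lambda>z. z \<noteq> 0" bs t] by (simp add: sgn_0_0)
next
  case (Dvd d t)
  show ?case
    using eventually_periodic_dvd_Inum by simp
next
  case (NDvd d t)
  show ?case
    using eventually_periodic_comp2 [OF eventually_periodic_dvd_Inum eventually_periodic_const,
      of "\<lambda>P _. \<not> P"] by simp
next
  case (Not p)
  then show ?case
    using eventually_periodic_comp2 [OF _ eventually_periodic_const, of _ "\<lambda>P _. \<not> P"] by simp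
next
  case (And p q)
  then show ?case
    using eventually_periodic_comp2 [of _ _ "(\<and>)"] by simp
next
  case (Or p q)
  then show ?case
    using eventually_periodic_comp2 [of _ _ "(\<or>)"] by simp
next
  case (Imp p q)
  then show ?case
    using eventually_periodic_comp2 [of _ _ "(\<longrightarrow>)"] by simp
next
  case (Iff p q)
  then show ?case
    using eventually_periodic_comp2 [of _ _ "(=)"] by simp
\<comment> \<open>\<open>Closed\<close> and \<open>NClosed\<close> are evaluated in
  \<open>bbs\<close>, hence constant in \<open>x\<close>; quantified formulas are excluded by
  \<open>qfree\<close>.\<close>
qed (simp_all add: eventually_periodic_const)

text \<open>Cooper's procedure \<open>pa\<close> turns \<open>p\<close> into an equivalent
  quantifier-free formula, by \<open>mirqe\<close>.\<close>

lemma eventually_periodic_Ifm: "eventually_periodic (\<lambda>x. Ifm bbs (x # bs) p)"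
  using eventually_periodic_qfree [of "pa p" bbs bs] by (simp add: mirqe)

section \<open>Translation of formulas over the naturals into integer Presburger formulas\<close>

primrec num_of_term :: "(nat \<Rightarrow> nat) \<Rightarrow> add_term \<Rightarrow> num" where
  "num_of_term \<sigma> (Var x) = Bound (\<sigma> x)"
| "num_of_term \<sigma> (add_term.Add t u) = num.Add (num_of_term \<sigma> t) (num_of_term \<sigma> u)"

text \<open>The target uses de Bruijn indices and ranges over the integers: \<sigma> records the
  current index of each named variable, and quantifiers are relativized to nonnegative
  values.\<close>

primrec fm_of_form :: "(nat \<Rightarrow> nat) \<Rightarrow> add_form \<Rightarrow> fm" where
  "fm_of_form \<sigma> (add_form.Eq t u) = fm.Eq (Sub (num_of_term \<sigma> t) (num_of_term \<sigma> u))"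
| "fm_of_form \<sigma> (add_form.Neg p) = Not (fm_of_form \<sigma> p)"
| "fm_of_form \<sigma> (Conj p q) = And (fm_of_form \<sigma> p) (fm_of_form \<sigma> q)"
| "fm_of_form \<sigma> (Exists x p) =
     E (And (Ge (Bound 0)) (fm_of_form (\<lambda>y. if y = x then 0 else Suc (\<sigma> y)) p))"

lemma Inum_num_of_term:
  "(\<And>x. x \<in> term_vars t \<Longrightarrow> bs ! \<sigma> x = int (e x)) \<Longrightarrow>
    Inum bs (num_of_term \<sigma> t) = int (term_val e t)"
  by (induction t) auto

lemma ex_int_nonneg: "(\<exists>x::int. x \<ge> 0 \<and> P x) \<longleftrightarrow> (\<exists>n. P (int n))"
  by (metis of_nat_0_le_iff zero_le_imp_eq_int)

lemma Ifm_fm_of_form: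
  "(\<And>x. x \<in> free_vars p \<Longrightarrow> bs ! \<sigma> x = int (e x)) \<Longrightarrow>
    Ifm bbs bs (fm_of_form \<sigma> p) \<longleftrightarrow> sat e p"
proof (induction p arbitrary: \<sigma> bs e)
  case (Eq t u)
  then show ?case
    by (simp add: Inum_num_of_term)
next
  case (Exists x p)
  have "Ifm bbs (int n # bs) (fm_of_form (\<lambda>y. if y = x then 0 else Suc (\<sigma> y)) p)
      \<longleftrightarrow> sat (e(x := n)) p" for n
    using Exists.prems by (intro Exists.IH) auto
  then show ?case
    by (simp add: ex_int_nonneg)
qed simp_all

text \<open>The tail \<open>bs\<close> stays arbitrary so that \<open>q\<close> can be used beneath
  further variables.\<close>

lemma definable_fun_fm:
  assumes "definable_fun f"
  obtains q where "\<And>a1 a2 b1 b2 bs.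
    Ifm bbs (int a1 # int a2 # int b1 # int b2 # bs) q \<longleftrightarrow> f (a1, a2) = (b1, b2)"
proof -
  let ?R = "{[a1, a2, b1, b2] |a1 a2 b1 b2. f (a1, a2) = (b1, b2)}"
  obtain p where fv: "free_vars p \<subseteq> {..<4}" and R: "?R = {map e [0..<4] |e. sat e p}"
    using assms unfolding definable_fun_def definable_rel_def by blast
  have upt: "[0..<4] = [0, 1, 2, 3::nat]"
    by (simp add: upt_rec)
  have "Ifm bbs (int a1 # int a2 # int b1 # int b2 # bs) (fm_of_form id p)
      \<longleftrightarrow> f (a1, a2) = (b1, b2)" for a1 a2 b1 b2 bs
  proof -
    have sat: "Ifm bbs (int a1 # int a2 # int b1 # int b2 # bs) (fm_of_form id p) \<longleftrightarrow> sat e p"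
      if "map e [0..<4] = [a1, a2, b1, b2]" for e
    proof (rule Ifm_fm_of_form)
      fix x
      assume "x \<in> free_vars p"
      then have "x \<in> {0, 1, 2, 3}"
        using fv by auto
      then show "(int a1 # int a2 # int b1 # int b2 # bs) ! id x = int (e x)"
        using that by (auto simp: upt)
    qed
    have "f (a1, a2) = (b1, b2) \<longleftrightarrow> [a1, a2, b1, b2] \<in> ?R"
      by simp
    also have "\<dots> \<longleftrightarrow> (\<exists>e. map e [0..<4] = [a1, a2, b1, b2] \<and> sat e p)"
      unfolding R by (auto simp: eq_commute)
    also have "\<dots> \<longleftrightarrow> (\<exists>e. map e [0..<4] = [a1, a2, b1, b2] \<and>
        Ifm bbs (int a1 # int a2 # int b1 # int b2 # bs) (fm_of_form id p))"
      by (auto simp only: sat cong: conj_cong)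
    also have "\<dots> \<longleftrightarrow> Ifm bbs (int a1 # int a2 # int b1 # int b2 # bs) (fm_of_form id p)"
    proof -
      have "map (\<lambda>x. [a1, a2, b1, b2] ! x) [0..<4] = [a1, a2, b1, b2]"
        by (simp add: upt)
      then show ?thesis
        by metis
    qed
    finally show ?thesis
      by blast
  qed
  then show ?thesis
    using that by blast
qed

text \<open>Projecting the graph makes \<open>S\<close> definable by a formula in one variable. The
  index \<open>j\<close> selects the edge of the quadrant.\<close>

lemma definable_fun_edge_sums_periodic:
  assumes "definable_fun f"
    and S: "S = {b1 + b2 |a1 a2 b1 b2. f (a1, a2) = (b1, b2) \<and> [a1, a2] ! j = 0}"
    and j: "j < 2"
  obtains d m where "d > 0" "\<And>n. n \<ge> m \<Longrightarrow> n + d \<in> S \<longleftrightarrow> n \<in> S"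
proof -
  obtain q where q: "\<And>a1 a2 b1 b2 bs.
      Ifm [] (int a1 # int a2 # int b1 # int b2 # bs) q \<longleftrightarrow> f (a1, a2) = (b1, b2)"
    using definable_fun_fm [OF assms(1)] by blast
  \<comment> \<open>From the outside in, the quantifiers bind \<open>b2\<close>, \<open>b1\<close>,
    \<open>a2\<close>, \<open>a1\<close>. In the matrix, indices 0 to 3 are thus \<open>a1\<close>,
    \<open>a2\<close>, \<open>b1\<close>, \<open>b2\<close>, as \<open>q\<close> expects, and index
    4 is the candidate sum.\<close>
  define r where "r = E (And (Ge (Bound 0)) (E (And (Ge (Bound 0)) (E (And (Ge (Bound 0))
    (E (And (Ge (Bound 0)) (And q (And (fm.Eq (Bound j))
      (fm.Eq (Sub (Bound 4) (num.Add (Bound 2) (Bound 3)))))))))))))"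
  have r: "Ifm [] [int n] r \<longleftrightarrow> n \<in> S" for n
  proof -
    have "Ifm [] [int n] r \<longleftrightarrow> (\<exists>b2 b1 a2 a1. f (a1, a2) = (b1, b2) \<and>
        [int a1, int a2, int b1, int b2, int n] ! j = 0 \<and> int n = int b1 + int b2)"
      unfolding r_def by (simp add: ex_int_nonneg q)
    also have "\<dots> \<longleftrightarrow> n \<in> S"
    proof -
      have "[int a1, int a2, int b1, int b2, int n] ! j = int ([a1, a2] ! j)" for a1 a2 b1 b2
        using j by (auto simp: less_2_cases_iff)
      then show ?thesis
        unfolding S by (auto simp flip: of_nat_add)
    qed
    finally show ?thesis .
  qed
  obtain d m where d: "d > 0"
    and per: "\<And>x k::nat. x \<ge> m \<Longrightarrow> Ifm [] [x + int k * d] r = Ifm [] [x] r"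
    using eventually_periodic_Ifm [of "[]" "[]" r] unfolding eventually_periodic_def by blast
  show ?thesis
  proof (rule that)
    show "nat d > 0"
      using d by simp
    show "n + nat d \<in> S \<longleftrightarrow> n \<in> S" if "n \<ge> nat m" for n
      using per [of "int n" 1] that d r [of "n + nat d"] r [of n] by simp
  qed
qed

section \<open>Strictly increasing sequences with eventually periodic range\<close>

text \<open>Far out, adding \<open>d\<close> is an order isomorphism from one final segment of the
  range onto another, so it shifts the indices of the increasing enumeration by a constant
  \<open>c\<close>.\<close>

lemma strict_mono_periodic_range:
  fixes g :: "nat \<Rightarrow> nat"
  assumes g: "strict_mono g" and "d > 0"
    and per: "\<And>n. n \<ge> m \<Longrightarrow> n + d \<in> range g \<longleftrightarrow> n \<in> range g"
  obtains n c where "c > 0" "\<And>k. g (n + k * c) = g n + k * d"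
proof -
  have ge: "g n \<ge> m" if "n \<ge> m" for n
    using strict_mono_imp_increasing [OF g, of n] that by linarith
  obtain l where l: "g l = g m + d"
    using per [OF ge [of m]] by auto
  then have "l > m"
    using \<open>d > 0\<close> g by (metis less_add_same_cancel1 strict_mono_less)
  define c where "c = l - m"
  have shift: "g (n + c) = g n + d" if "n \<ge> m" for n
    using that
  proof (induction n rule: dec_induct)
    case base
    then show ?case
      using l \<open>l > m\<close> by (simp add: c_def)
  next
    case (step n)
    \<comment> \<open>This element of the range lies above \<open>g (n + c)\<close>, so the next
      value \<open>g (Suc n + c)\<close> is at most it.\<close>
    have "g (Suc n) + d \<in> range g"
      using per [OF ge [of "Suc n"]] step by simp
    then obtain i where i: "g i = g (Suc n) + d"
      by auto
    then have "g (n + c) < g i"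
      using step strict_monoD [OF g, of n "Suc n"] by simp
    then have "Suc n + c \<le> i"
      using g by (simp add: strict_mono_less)
    then have upper: "g (Suc n + c) \<le> g (Suc n) + d"
      using g i by (metis strict_mono_less_eq)
    have gt: "g n + d < g (Suc n + c)"
      using step strict_monoD [OF g, of "n + c" "Suc n + c"] by simp
    \<comment> \<open>For the converse bound, shift back by \<open>d\<close>: the result lies in the
      range above \<open>g n\<close>, hence is at least \<open>g (Suc n)\<close>. The equation
      ensures that the subtraction on naturals is not truncated.\<close>
    have eq: "g (Suc n + c) - d + d = g (Suc n + c)"
      using gt by linarith
    moreover have "g (Suc n + c) - d \<ge> m"
      using gt ge [of n] step by linarith
    ultimately have "g (Suc n + c) - d \<in> range g"
      using per [of "g (Suc n + c) - d"] by simp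
    then obtain i' where i': "g i' = g (Suc n + c) - d"
      by (metis rangeE)
    then have "g n < g i'"
      using gt by linarith
    then have "Suc n \<le> i'"
      using g by (simp add: strict_mono_less)
    then have "g (Suc n) \<le> g (Suc n + c) - d"
      using g i' by (metis strict_mono_less_eq)
    then show ?case
      using upper eq by linarith
  qed
  show ?thesis
  proof (rule that)
    show "c > 0"
      using \<open>l > m\<close> by (simp add: c_def)
    show "g (m + k * c) = g m + k * d" for k
    proof (induction k)
      case (Suc k)
      then show ?case
        using shift [of "m + k * c"] by (simp add: algebra_simps)
    qed simp
  qed
qed

lemma is_square_if_mult_square_eq:
  fixes s c d :: nat
  assumes "d\<^sup>2 = s * c\<^sup>2" "c > 0"
  shows "is_square s"
proof -
  have "c\<^sup>2 dvd d\<^sup>2"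
    using assms(1) by simp
  then have "c dvd d"
    by simp
  then obtain k where "d = c * k" ..
  then have "s = k\<^sup>2"
    using assms by (simp add: power_mult_distrib)
  then show ?thesis
    by simp
qed

text \<open>The bounds force \<open>g\<close> to be strictly increasing and fix its growth; along an
  arithmetic progression on which \<open>g\<close> is linear, comparing leading coefficients gives
  the square.\<close>

lemma is_square_if_periodic_range:
  fixes s :: nat and g :: "nat \<Rightarrow> nat"
  assumes "s > 0"
    and lower: "\<And>n. g n * (g n + 1) \<le> s * (n * (n + 1))"
    and upper: "\<And>n. s * (n * (n + 1)) < (g n + 1) * (g n + 2)"
    and "d > 0" and per: "\<And>n. n \<ge> m \<Longrightarrow> n + d \<in> range g \<longleftrightarrow> n \<in> range g"
  shows "is_square s"
proof -
  have "g n < g (Suc n)" for n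
  proof (rule ccontr)
    assume "\<not> g n < g (Suc n)"
    then have "(g (Suc n) + 1) * (g (Suc n) + 2) \<le> (g n + 1) * (g n + 2)"
      by (intro mult_le_mono) auto
    \<comment> \<open>Subtracting the lower bound at \<open>n\<close> leaves
      \<open>2 * s * (n + 1) < 2 * (g n + 1)\<close>. Then \<open>g n\<close> is at least
      \<open>s * (n + 1)\<close>, too large for that same lower bound.\<close>
    then have "s * ((n + 1) * (n + 2)) < g n * (g n + 1) + 2 * (g n + 1)"
      using upper [of "Suc n"] by (simp add: algebra_simps)
    then have "s * (n + 1) < g n + 1"
      using lower [of n] by (simp add: algebra_simps)
    then have "(s * (n + 1)) * (s * (n + 1) + 1) \<le> g n * (g n + 1)"
      by (intro mult_le_mono) auto
    also have "\<dots> \<le> s * (n * (n + 1))"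
      by (rule lower)
    finally have "s * (n + 1) * (s * (n + 1) + 1) \<le> s * (n + 1) * n"
      by (simp only: mult_ac)
    then have "s * (n + 1) + 1 \<le> n"
      by (rule mult_left_le_imp_le) (use \<open>s > 0\<close> in simp)
    then have "s * (n + 1) < 1 * (n + 1)"
      by simp
    then show False
      using \<open>s > 0\<close> unfolding mult_less_cancel2 by simp
  qed
  then have "strict_mono g"
    by (simp add: strict_mono_Suc_iff)
  then obtain n c where c: "c > 0" and g: "\<And>k. g (n + k * c) = g n + k * d"
    using strict_mono_periodic_range [OF _ \<open>d > 0\<close> per] by blast
  define G P N C where "G = real (g n)" and "P = real d" and "N = real n" and "C = real c"
  have pos: "P > 0" "C > 0"
    using \<open>d > 0\<close> c by (simp_all add: P_def C_def)
  have lim1: "(\<lambda>k. (G + real k * P) * (G + real k * P + 1) / real k ^ 2) \<longlonglongrightarrow> P\<^sup>2"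
    using pos by (real_asymp simp: power2_eq_square)
  have lim2: "(\<lambda>k. (N + real k * C) * (N + real k * C + 1) / real k ^ 2) \<longlonglongrightarrow> C\<^sup>2"
    using pos by (real_asymp simp: power2_eq_square)
  have lim3: "(\<lambda>k. (G + real k * P + 1) * (G + real k * P + 2) / real k ^ 2) \<longlonglongrightarrow> P\<^sup>2"
    using pos by (real_asymp simp: power2_eq_square)
  have lower': "(G + real k * P) * (G + real k * P + 1) \<le>
      s * ((N + real k * C) * (N + real k * C + 1))" for k
    using lower [of "n + k * c", unfolded g, THEN of_nat_mono [where 'a = real]]
    by (simp add: G_def P_def N_def C_def algebra_simps)
  have upper': "s * ((N + real k * C) * (N + real k * C + 1)) \<le>
      (G + real k * P + 1) * (G + real k * P + 2)" for k
    using upper [of "n + k * c", unfolded g, THEN less_imp_le, THEN of_nat_mono [where 'a = real]]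
    by (simp add: G_def P_def N_def C_def algebra_simps)
  have "P\<^sup>2 \<le> s * C\<^sup>2"
  proof (rule LIMSEQ_le [OF lim1 tendsto_mult_left [OF lim2]], intro exI allI impI)
    \<comment> \<open>At \<open>k = 0\<close> both quotients are 0 by convention, so no case needs
      to be excluded.\<close>
    show "(G + real k * P) * (G + real k * P + 1) / real k ^ 2 \<le>
        s * ((N + real k * C) * (N + real k * C + 1) / real k ^ 2)" for k
      using divide_right_mono [OF lower' [of k], of "real k ^ 2"] by simp
  qed
  moreover have "s * C\<^sup>2 \<le> P\<^sup>2"
  proof (rule LIMSEQ_le [OF tendsto_mult_left [OF lim2] lim3], intro exI allI impI)
    show "s * ((N + real k * C) * (N + real k * C + 1) / real k ^ 2) \<le>
        (G + real k * P + 1) * (G + real k * P + 2) / real k ^ 2" for k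
      using divide_right_mono [OF upper' [of k], of "real k ^ 2"] by simp
  qed
  ultimately have "real (d\<^sup>2) = real (s * c\<^sup>2)"
    by (simp add: P_def C_def)
  then have "d\<^sup>2 = s * c\<^sup>2"
    by (simp only: of_nat_eq_iff)
  then show ?thesis
    using is_square_if_mult_square_eq c by blast
qed

section \<open>The Cantor polynomials on an edge of the quadrant\<close>

text \<open>With \<open>t = x + y\<close>, the doubled value is \<open>t * (t + 1)\<close> plus
  \<open>2 * y\<close> or \<open>2 * x\<close>, an excess of at most \<open>2 * t\<close>. The value
  therefore determines \<open>t\<close>.\<close>

lemma two_cantor_bounds:
  "(x + y) * (x + y + 1) \<le> 2 * cantor i (x, y)"
  "2 * cantor i (x, y) < (x + y + 1) * (x + y + 2)"
  unfolding cantor_def by (simp_all add: two_cantor1 two_cantor2 power2_eq_square algebra_simps)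

theorem theorem13:
  fixes s i :: nat and f :: "nat \<times> nat \<Rightarrow> nat \<times> nat"
  assumes "\<not> is_square s"
    and "i \<in> {1, 2}"
    and "\<And>a. f a = inv (cantor i) (s * cantor i a)"
  shows "\<not> definable_fun f"
proof
  assume def: "definable_fun f"
  have cantor_f: "cantor i (f a) = s * cantor i a" for a
    using assms(3) bij_cantor [of i] by (simp add: bij_is_surj surj_f_inv_f)
  \<comment> \<open>The coordinate that vanishes on the edge with triangular values: the second for
    \<open>cantor1\<close>, the first for \<open>cantor2\<close>.\<close>
  define j :: nat where "j = (if i = 1 then 1 else 0)"
  define edge :: "nat \<Rightarrow> nat \<times> nat" where "edge n = (if i = 1 then (n, 0) else (0, n))" for n
  define g where "g n = fst (f (edge n)) + snd (f (edge n))" for n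
  have two_edge: "2 * cantor i (edge n) = n * (n + 1)" for n
    by (simp add: edge_def cantor_def two_cantor1 two_cantor2 power2_eq_square algebra_simps)
  have bounds: "g n * (g n + 1) \<le> s * (n * (n + 1))" "s * (n * (n + 1)) < (g n + 1) * (g n + 2)"
    for n
  proof -
    have "2 * cantor i (f (edge n)) = s * (n * (n + 1))"
      using two_edge [of n] by (simp only: cantor_f mult.left_commute [of 2])
    then show "g n * (g n + 1) \<le> s * (n * (n + 1))" "s * (n * (n + 1)) < (g n + 1) * (g n + 2)"
      using two_cantor_bounds [where i = i and x = "fst (f (edge n))" and y = "snd (f (edge n))"]
      unfolding g_def prod.collapse by simp_all
  qed
  have range: "range g = {b1 + b2 |a1 a2 b1 b2. f (a1, a2) = (b1, b2) \<and> [a1, a2] ! j = 0}"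
    (is "_ = ?S")
  proof (intro equalityI subsetI)
    show "x \<in> ?S" if x: "x \<in> range g" for x
    proof -
      obtain n where "x = g n"
        using x by auto
      moreover have "[fst (edge n), snd (edge n)] ! j = 0"
        by (simp add: j_def edge_def)
      ultimately show ?thesis
        unfolding g_def by (smt (verit) mem_Collect_eq prod.collapse)
    qed
    show "x \<in> range g" if x: "x \<in> ?S" for x
    proof -
      obtain a1 a2 b1 b2 where *: "x = b1 + b2" "f (a1, a2) = (b1, b2)" "[a1, a2] ! j = 0"
        using x by blast
      \<comment> \<open>As one coordinate is 0, the point \<open>(a1, a2)\<close> equals
        \<open>edge (a1 + a2)\<close>.\<close>
      then have "x = g (a1 + a2)"
        by (auto simp: g_def edge_def j_def split: if_splits)
      then show ?thesis
        by simp
    qed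
  qed
  have "j < 2"
    by (simp add: j_def)
  from definable_fun_edge_sums_periodic [OF def range this]
  obtain d m where "d > 0" "\<And>n. n \<ge> m \<Longrightarrow> n + d \<in> range g \<longleftrightarrow> n \<in> range g"
    by blast
  moreover have "s > 0"
    using assms(1) by (cases "s = 0") auto
  ultimately have "is_square s"
    using is_square_if_periodic_range bounds by blast
  with assms(1) show False ..
qed

end
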